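(* If $n$ is a non-negative integer, then $$\sum_{k=0}^\infty \frac{\left(\frac12\right)_k^3}{4^k\,k!^3}\,\frac{\prod_{j=1}^{2n}(2k+j)}{\prod_{j=1}^n (k+j)^2(2k-2j+1)}\,(6k+1+2n)=\frac{(-1)^n\,2^{n+2}}{\left(\frac12\right)_n}\,\frac1\pi.$$ In particular, $$\sum_{k=0}^\infty \frac{\left(\frac12\right)_k^3}{4^k\,k!^3}\,\frac{(2k+1)^2}{(k+1)(2k-1)}=-\frac{8}{3\pi}.$$
   Context: $(x)_n=\prod_{j=0}^{n-1}(x+j)$ is the Pochhammer symbol. Empty products equal $1$, and $\prod_{j=1}^n (k+j)^2(2k-2j+1)$ extends over both factors. *)

theory Defs
  imports Complex_Main
begin

end

theory Submission
  imports
    Defs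
    "HOL-Analysis.Gamma_Function"
    "HOL-Analysis.Generalised_Binomial_Theorem"
    "HOL-Real_Asymp.Real_Asymp"
begin

text \<open>
  After division by the right-hand side (up to the factor $4/\pi$), the $k$-th summand becomes
  \[ F(n,k) = \frac{(1/2)_{n+k}}{(n+k)!}\,
       \frac{(1/2)_k\,(1/2-n)_k}{4^k\,k!^2}\,(6k+1+2n), \]
  so the claim is $S(n) = \sum_k F(n,k) = 4/\pi$. With the convention that the first factor
  vanishes for $n+k<0$, the function $F$ makes sense for every integer $n$, and it has a
  Wilf--Zeilberger mate: $F(n+1,k)-F(n,k)=G(n,k)-G(n,k-1)$ with
  $G(n,k) = (2k+1)\,\frac{(1/2)_{n+k+1}}{(n+k+1)!}\,\frac{(1/2)_k(1/2-n)_k}{4^k\,k!^2}$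
  and $G(n,-1)=0$ (lemmas \<open>wz_pair_0\<close> and \<open>wz_pair_Suc\<close>). Since $G(n,k)\to 0$ as
  $k\to\infty$, telescoping shows that $S(n)$ does not depend on $n$.

  The constant is found by letting $n\to-\infty$. (For $n\to+\infty$ there is no limit term by
  term, as $(1/2-n)_k$ grows like $n^k$ and the first factor decays only like $n^{-1/2}$.)
  For $n=-m$ the first $m$ summands vanish, and with $k=m+j$
  the $j$-th remaining summand tends to
  $\frac{4}{\sqrt2\,\pi}\,\frac{(1/2)_j}{j!}\,2^{-j}$ as $m\to\infty$, by the asymptotics
  $\frac{(1/2)_m}{m!}\sim\frac1{\sqrt{\pi m}}$. The summands are dominated by a constant multiple
  of $(6j+1)2^{-j}$, so Tannery's theorem and the binomial series
  $\sum_j \frac{(1/2)_j}{j!}2^{-j} = (1-\frac12)^{-1/2} = \sqrt2$ give $S = 4/\pi$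
  (lemma \<open>wz_sum_value\<close>). The second claim is the case $n=1$, divided by $6$.
\<close>

section \<open>The summand and its Wilf--Zeilberger mate\<close>

text \<open>
  For $i\ge0$ this is $\binom{2i}{i}/4^i$. Extended by zero to negative $i$ it satisfies its
  first-order recurrence at every integer, also at the boundary $i=-1$; this is what allows the
  parameter $n$ below to be negative.
\<close>

definition central_binom :: "int \<Rightarrow> real" where
  "central_binom i = (if i < 0 then 0 else pochhammer (1/2) (nat i) / fact (nat i))"

definition weight :: "int \<Rightarrow> nat \<Rightarrow> real" where
  "weight n k = pochhammer (1/2) k * pochhammer (1/2 - of_int n) k / (4 ^ k * fact k ^ 2)"

definition wz_term :: "int \<Rightarrow> nat \<Rightarrow> real" where
  "wz_term n k = central_binom (n + int k) * weight n k * (6 * real k + 1 + 2 * of_int n)"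

definition wz_mate :: "int \<Rightarrow> nat \<Rightarrow> real" where
  "wz_mate n k = (2 * real k + 1) * central_binom (n + int k + 1) * weight n k"

lemma central_binom_of_nat: "central_binom (int k) = pochhammer (1/2) k / fact k"
  by (simp add: central_binom_def)

lemma central_binom_rec: "2 * (of_int i + 1) * central_binom (i + 1) = (2 * of_int i + 1) * central_binom i"
proof -
  consider "i \<ge> 0" | "i = -1" | "i < -1" by linarith
  then show ?thesis
  proof cases
    case 1
    then obtain j where i: "i = int j" using nonneg_int_cases by blast
    have "central_binom (i + 1) = pochhammer (1/2) (Suc j) / fact (Suc j)"
      using central_binom_of_nat[of "Suc j"] by (simp add: i add.commute)
    also have "\<dots> = central_binom i * (real j + 1/2) / (real j + 1)"
      by (simp add: i central_binom_of_nat pochhammer_rec' field_simps)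
    finally show ?thesis by (simp add: i field_simps)
  qed (auto simp: central_binom_def)
qed

lemma central_binom_bounds: "0 \<le> central_binom i" "central_binom i \<le> 1"
proof -
  have *: "0 \<le> central_binom (int k) \<and> central_binom (int k) \<le> 1" for k
  proof (induction k)
    case 0
    then show ?case by (simp add: central_binom_def)
  next
    case (Suc k)
    have "central_binom (int (Suc k)) = central_binom (int k) * ((real k + 1/2) / (real k + 1))"
      using central_binom_rec[of "int k"] by (simp add: field_simps add.commute)
    moreover have "(real k + 1/2) / (real k + 1) \<le> 1" "0 \<le> (real k + 1/2) / (real k + 1)" by auto
    ultimately show ?case using Suc by (metis mult_le_one mult_nonneg_nonneg)
  qed
  have "0 \<le> central_binom i \<and> central_binom i \<le> 1"
  proof (cases "i < 0")
    case True
    then show ?thesis by (simp add: central_binom_def)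
  next
    case False
    then show ?thesis using *[of "nat i"] by simp
  qed
  then show "0 \<le> central_binom i" "central_binom i \<le> 1" by auto
qed

lemma weight_Suc:
  "4 * (real k + 1)\<^sup>2 * weight n (Suc k) = (real k + 1/2) * (real k + 1/2 - of_int n) * weight n k"
proof -
  have "weight n (Suc k) = (1/2 + real k) * pochhammer (1/2) k * ((1/2 - of_int n + real k) * pochhammer (1/2 - of_int n) k)
     / (4 * 4 ^ k * ((real k + 1) * fact k) ^ 2)"
    by (simp add: weight_def pochhammer_rec' add_ac)
  then show ?thesis
    by (simp add: weight_def power2_eq_square divide_simps) (simp add: algebra_simps)
qed

text \<open>
  Raising $n$ by one lowers the base of $(1/2-n)_k$ by one, which changes only its first and
  last factor. Stated without division, since this is how it combines with \<open>weight_Suc\<close>.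
\<close>

lemma weight_shift:
  "(real k - 1/2 - of_int n) * weight (n + 1) k = - (of_int n + 1/2) * weight n k"
proof -
  have "(real k - 1/2 - of_int n) * pochhammer (- 1/2 - of_int n) k
      = - (of_int n + 1/2) * pochhammer (1/2 - of_int n :: real) k"
    using pochhammer_rec[of "-1/2 - of_int n :: real" k] pochhammer_rec'[of "-1/2 - of_int n :: real" k]
    by (simp add: algebra_simps)
  then have "(real k - 1/2 - of_int n) * pochhammer (- 1/2 - of_int n) k * (pochhammer (1/2) k / (4 ^ k * fact k ^ 2))
      = - (of_int n + 1/2) * pochhammer (1/2 - of_int n :: real) k * (pochhammer (1/2) k / (4 ^ k * fact k ^ 2))"
    by simp
  moreover have "1/2 - of_int (n + 1) = (- 1/2 - of_int n :: real)" by simp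
  ultimately show ?thesis unfolding weight_def by (simp add: mult_ac)
qed

text \<open>
  A half-integer differs from an integer, so the factors divided by below never vanish.
\<close>

lemma half_odd_nonzero: "real k - 1/2 - of_int n \<noteq> 0"
proof -
  have "2 * int k - 1 - 2 * n \<noteq> 0" by presburger
  then have "real_of_int (2 * int k - 1 - 2 * n) \<noteq> 0"
    by (simp only: of_int_eq_0_iff not_False_eq_True)
  then show ?thesis by simp
qed

text \<open>
  The equation of the pair at its left end, where the mate at $k=-1$ counts as zero.
\<close>

lemma wz_pair_0: "wz_term (n + 1) 0 - wz_term n 0 = wz_mate n 0"
  using central_binom_rec[of n] by (simp add: wz_term_def wz_mate_def weight_def algebra_simps)

text \<open>
  All four terms are multiples of $c=\mathit{weight}(n,k+1)/(k+1/2-n)$ times one of two adjacent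
  values of \<open>central_binom\<close>. The recurrence between these two values reduces the
  claim to a polynomial identity in $k$ and $n$.
\<close>

lemma wz_pair_Suc:
  "wz_term (n + 1) (Suc k) - wz_term n (Suc k) = wz_mate n (Suc k) - wz_mate n k"
proof -
  define x y where "x = real k + 1" and "y = real_of_int n"
  define c where "c = weight n (Suc k) / (x - 1/2 - y)"
  define A B where "A = central_binom (n + int k + 1)" and "B = central_binom (n + int k + 2)"
  have nz: "x - 1/2 - y \<noteq> 0" using half_odd_nonzero[of "Suc k" n] by (simp add: x_def y_def add.commute)
  have w1: "weight n (Suc k) = (x - 1/2 - y) * c" using nz by (simp add: c_def)
  have w2: "weight (n + 1) (Suc k) = - (y + 1/2) * c"
  proof -
    have "(x - 1/2 - y) * weight (n + 1) (Suc k) = (x - 1/2 - y) * (- (y + 1/2) * c)"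
      using weight_shift[of "Suc k" n] unfolding w1 by (simp add: x_def y_def algebra_simps)
    then show ?thesis using nz mult_left_cancel by blast
  qed
  have w0: "(2 * real k + 1) * weight n k = 8 * x\<^sup>2 * c"
  proof -
    have "(x - 1/2 - y) * ((2 * real k + 1) * weight n k) = (x - 1/2 - y) * (8 * x\<^sup>2 * c)"
      using weight_Suc[of k n] unfolding w1 by (simp add: x_def y_def algebra_simps)
    then show ?thesis using nz mult_left_cancel by blast
  qed
  have B: "2 * (y + x + 1) * B = (2 * (y + x) + 1) * A"
    using central_binom_rec[of "n + int k + 1"] by (simp add: A_def B_def x_def y_def algebra_simps)
  have i1: "n + 1 + int (Suc k) = n + int k + 2" "n + int (Suc k) = n + int k + 1"
     "n + int k + 1 + 1 = n + int k + 2" by simp_all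
  have l: "wz_term (n + 1) (Suc k) - wz_term n (Suc k)
     = c * (- B * (y + 1/2) * (6 * x + 3 + 2 * y) - A * (x - 1/2 - y) * (6 * x + 1 + 2 * y))"
    unfolding wz_term_def i1 w1 w2 A_def[symmetric] B_def[symmetric]
    by (simp add: x_def y_def algebra_simps)
  have "wz_mate n k = A * ((2 * real k + 1) * weight n k)"
    by (simp add: wz_mate_def A_def)
  then have r: "wz_mate n (Suc k) - wz_mate n k = c * ((2 * x + 1) * B * (x - 1/2 - y) - 8 * x\<^sup>2 * A)"
    unfolding w0 unfolding wz_mate_def i1 w1 A_def[symmetric] B_def[symmetric]
    by (simp add: x_def y_def algebra_simps)
  have "- B * (y + 1/2) * (6 * x + 3 + 2 * y) - A * (x - 1/2 - y) * (6 * x + 1 + 2 * y)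
      = (2 * x + 1) * B * (x - 1/2 - y) - 8 * x\<^sup>2 * A"
    using B by algebra
  then show ?thesis using l r by simp
qed


section \<open>The sum does not depend on the parameter\<close>

text \<open>
  The ratio of consecutive weights tends to $1/4$. From $k>|n|$ on it is at most $1/2$, which
  absorbs the linear factor with a ratio of at most $3/4$. A constant multiple of this series
  dominates both members of the pair.
\<close>

lemma summable_weight: "summable (\<lambda>k. (real k + 1) * \<bar>weight n k\<bar>)"
proof (rule summable_ratio_test[where c = "3/4" and N = "nat \<bar>n\<bar> + 1"])
  fix k :: nat
  assume k: "k \<ge> nat \<bar>n\<bar> + 1"
  define x where "x = real k + 1"
  have n: "\<bar>real_of_int n\<bar> \<le> real k" and k1: "real k \<ge> 1" using k by linarith+
  have "4 * x\<^sup>2 * \<bar>weight n (Suc k)\<bar> = \<bar>4 * (real k + 1)\<^sup>2 * weight n (Suc k)\<bar>"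
    by (simp add: abs_mult x_def)
  also have "\<dots> = (real k + 1/2) * \<bar>real k + 1/2 - of_int n\<bar> * \<bar>weight n k\<bar>"
    unfolding weight_Suc by (simp add: abs_mult)
  also have "\<dots> \<le> x * (2 * x) * \<bar>weight n k\<bar>"
    using n by (intro mult_mono) (auto simp: x_def)
  finally have "4 * x\<^sup>2 * \<bar>weight n (Suc k)\<bar> \<le> 4 * x\<^sup>2 * (1/2 * \<bar>weight n k\<bar>)"
    by (simp add: power2_eq_square mult_ac)
  moreover have "4 * x\<^sup>2 > 0" by (simp add: x_def)
  ultimately have *: "\<bar>weight n (Suc k)\<bar> \<le> 1/2 * \<bar>weight n k\<bar>"
    using mult_le_cancel_left_pos by blast
  have "(real (Suc k) + 1) * \<bar>weight n (Suc k)\<bar> \<le> (3/2 * (real k + 1)) * (1/2 * \<bar>weight n k\<bar>)"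
    using k1 by (intro mult_mono *) auto
  also have "\<dots> = 3/4 * ((real k + 1) * \<bar>weight n k\<bar>)" by simp
  finally show "norm ((real (Suc k) + 1) * \<bar>weight n (Suc k)\<bar>) \<le> 3/4 * norm ((real k + 1) * \<bar>weight n k\<bar>)"
    unfolding real_norm_def by (subst (1 2) abs_of_nonneg) auto
qed simp

lemma summable_wz_term: "summable (wz_term n)"
proof (rule summable_comparison_test)
  define K where "K = 7 + 2 * \<bar>real_of_int n\<bar>"
  have "\<bar>wz_term n k\<bar> \<le> K * ((real k + 1) * \<bar>weight n k\<bar>)" for k
  proof -
    have "\<bar>6 * real k + 1 + 2 * of_int n\<bar> \<le> 6 * real k + 1 + 2 * \<bar>real_of_int n\<bar>" by linarith
    also have "\<dots> \<le> K * (real k + 1)"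
      by (simp add: K_def algebra_simps)
    finally have "central_binom (n + int k) * \<bar>weight n k\<bar> * \<bar>6 * real k + 1 + 2 * of_int n\<bar>
        \<le> 1 * \<bar>weight n k\<bar> * (K * (real k + 1))"
      by (intro mult_mono central_binom_bounds mult_nonneg_nonneg) auto
    then show ?thesis using central_binom_bounds(1)[of "n + int k"]
      by (simp add: wz_term_def abs_mult mult_ac)
  qed
  then show "\<exists>N. \<forall>k\<ge>N. norm (wz_term n k) \<le> K * ((real k + 1) * \<bar>weight n k\<bar>)" by auto
  show "summable (\<lambda>k. K * ((real k + 1) * \<bar>weight n k\<bar>))"
    by (intro summable_mult summable_weight)
qed

lemma wz_mate_tendsto_0: "wz_mate n \<longlonglongrightarrow> 0"
proof (rule tendsto_rabs_zero_cancel, rule tendsto_sandwich[OF _ _ tendsto_const])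
  show "\<forall>\<^sub>F k in sequentially. 0 \<le> \<bar>wz_mate n k\<bar>" by simp
  show "\<forall>\<^sub>F k in sequentially. \<bar>wz_mate n k\<bar> \<le> 2 * ((real k + 1) * \<bar>weight n k\<bar>)"
  proof (rule always_eventually, rule allI)
    fix k
    have "(2 * real k + 1) * central_binom (n + int k + 1) * \<bar>weight n k\<bar>
        \<le> (2 * (real k + 1)) * 1 * \<bar>weight n k\<bar>"
      by (intro mult_mono central_binom_bounds mult_nonneg_nonneg) auto
    moreover have "\<bar>wz_mate n k\<bar> = (2 * real k + 1) * central_binom (n + int k + 1) * \<bar>weight n k\<bar>"
      using central_binom_bounds(1)[of "n + int k + 1"] by (simp add: wz_mate_def abs_mult)
    ultimately show "\<bar>wz_mate n k\<bar> \<le> 2 * ((real k + 1) * \<bar>weight n k\<bar>)"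
      by (simp only: mult.assoc mult_1)
  qed
  show "(\<lambda>k. 2 * ((real k + 1) * \<bar>weight n k\<bar>)) \<longlonglongrightarrow> 0"
    using tendsto_mult[OF tendsto_const[of 2] summable_LIMSEQ_zero[OF summable_weight]] by simp
qed

lemma wz_sum_step: "suminf (wz_term (n + 1)) = suminf (wz_term n)"
proof -
  have "(\<lambda>k. wz_mate n (Suc k) - wz_mate n k) sums (0 - wz_mate n 0)"
    by (rule telescope_sums[OF wz_mate_tendsto_0])
  then have "(\<lambda>k. wz_term (n + 1) (Suc k) - wz_term n (Suc k)) sums - wz_mate n 0"
    by (simp add: wz_pair_Suc)
  then have "(\<lambda>k. wz_term (n + 1) k - wz_term n k) sums (- wz_mate n 0 + wz_mate n 0)"
    unfolding wz_pair_0[symmetric] by (subst (asm) sums_Suc_iff) simp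
  moreover have "(\<lambda>k. wz_term (n + 1) k - wz_term n k) sums
      (suminf (wz_term (n + 1)) - suminf (wz_term n))"
    by (intro sums_diff summable_sums summable_wz_term)
  ultimately show ?thesis using sums_unique2 by fastforce
qed

lemma wz_sum_const: "suminf (wz_term n) = suminf (wz_term 0)"
proof (induction n rule: int_induct[where k = 0])
  case (step1 i)
  then show ?case by (simp add: wz_sum_step)
next
  case (step2 i)
  then show ?case using wz_sum_step[of "i - 1"] by simp
qed simp

section \<open>Letting the parameter tend to minus infinity\<close>

definition shifted_weight :: "nat \<Rightarrow> nat \<Rightarrow> real" where
  "shifted_weight m j = weight (- int m) (m + j)"

text \<open>
  For $n=-m$ the summands with $k<m$ vanish, and the others carry the factor
  \<open>central_binom j\<close>, which does not depend on $m$.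
\<close>

lemma wz_term_neg_sums:
  "(\<lambda>j. central_binom (int j) * shifted_weight m j * (4 * real m + 6 * real j + 1)) sums suminf (wz_term 0)"
proof -
  have "wz_term (- int m) sums suminf (wz_term 0)"
    using summable_sums[OF summable_wz_term] wz_sum_const by metis
  moreover have "wz_term (- int m) k = 0" if "k < m" for k
    using that by (simp add: wz_term_def central_binom_def)
  ultimately have "(\<lambda>j. wz_term (- int m) (j + m)) sums suminf (wz_term 0)"
    by (subst sums_zero_iff_shift) auto
  then show ?thesis
    by (simp add: wz_term_def shifted_weight_def add.commute algebra_simps)
qed

lemma shifted_weight_nonneg: "shifted_weight m j \<ge> 0"
  by (auto simp: shifted_weight_def weight_def intro!: mult_nonneg_nonneg divide_nonneg_nonneg pochhammer_nonneg)

lemma shifted_weight_Suc: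
  "shifted_weight m (Suc j) =
     ((real m + real j + 1/2) * (2 * real m + real j + 1/2) / (4 * (real m + real j + 1)\<^sup>2)) * shifted_weight m j"
  using weight_Suc[of "m + j" "- int m"]
  by (simp add: shifted_weight_def divide_simps mult_ac add_ac)

text \<open>
  The geometric decay is uniform in $m$, which provides the dominating series for Tannery's
  theorem.
\<close>

lemma shifted_weight_le: "shifted_weight m j \<le> shifted_weight m 0 * (1/2) ^ j"
proof (induction j)
  case (Suc j)
  define x where "x = real m + real j + 1"
  have x: "x > 0" by (simp add: x_def)
  have "(real m + real j + 1/2) * (2 * real m + real j + 1/2) \<le> x * (2 * x)"
    by (intro mult_mono) (auto simp: x_def)
  then have "(real m + real j + 1/2) * (2 * real m + real j + 1/2) \<le> 1/2 * (4 * x\<^sup>2)"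
    by (simp add: power2_eq_square)
  then have "(real m + real j + 1/2) * (2 * real m + real j + 1/2) / (4 * (real m + real j + 1)\<^sup>2) \<le> 1/2"
    unfolding x_def[symmetric] using x by (subst pos_divide_le_eq) auto
  then have "shifted_weight m (Suc j) \<le> 1/2 * shifted_weight m j"
    unfolding shifted_weight_Suc by (intro mult_right_mono shifted_weight_nonneg)
  with Suc show ?case by simp
qed simp

text \<open>
  Up to inversion, this is the limit formula for $\Gamma(1/2)=\sqrt\pi$.
\<close>

lemma central_binom_asymptotic: "(\<lambda>m. central_binom (int m) * sqrt (real m)) \<longlonglongrightarrow> 1 / sqrt pi"
proof -
  have "(\<lambda>m. inverse (Gamma_series' (1/2 :: real) m)) \<longlonglongrightarrow> inverse (Gamma (1/2))"
    by (intro tendsto_inverse Gamma_series'_LIMSEQ) (simp add: Gamma_one_half_real)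
  moreover have "\<forall>\<^sub>F m in sequentially. inverse (Gamma_series' (1/2 :: real) m) = central_binom (int m) * sqrt (real m)"
    using eventually_gt_at_top[of 0]
  proof eventually_elim
    case (elim m)
    have "exp (1/2 * ln (real m)) = sqrt (real m)"
      using elim by (simp add: powr_half_sqrt[symmetric] powr_def)
    moreover have "fact m = real m * fact (m - 1)" using elim by (simp add: fact_reduce)
    moreover have "real m = sqrt (real m) * sqrt (real m)" by simp
    ultimately show ?case using elim
      by (simp add: Gamma_series'_def central_binom_of_nat divide_simps)
  qed
  ultimately show ?thesis
    by (simp add: Gamma_one_half_real inverse_eq_divide Lim_transform_eventually)
qed

text \<open>
  The two Pochhammer factors join to $(1/2)_{2m}$, and $4^m\,m!\,(1/2)_m=(2m)!$. Thus the weight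
  factors into two central binomial ratios, whose asymptotics are known.
\<close>

lemma shifted_weight_0: "shifted_weight m 0 = central_binom (int (2 * m)) * central_binom (int m)"
proof -
  have "pochhammer (1/2) (2 * m) = pochhammer (1/2 :: real) m * pochhammer (1/2 + real m) m"
    using pochhammer_product'[of "1/2 :: real" m m] by (simp add: mult_2)
  moreover have "fact (2 * m) = 4 ^ m * pochhammer (1/2 :: real) m * fact m"
    using fact_double[of m, where 'a = real] by (simp add: power_mult)
  moreover have "pochhammer (1/2 :: real) m \<noteq> 0" by (simp add: pochhammer_eq_0_iff)
  ultimately show ?thesis
    by (simp add: shifted_weight_def weight_def central_binom_of_nat del: of_nat_mult)
       (simp add: divide_simps power2_eq_square)
qed

lemma shifted_weight_tendsto:
  "(\<lambda>m. real m * shifted_weight m j) \<longlonglongrightarrow> 1 / (sqrt 2 * pi) * (1/2) ^ j"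
proof (induction j)
  case 0
  have "(\<lambda>m. (central_binom (int (2 * m)) * sqrt (real (2 * m))) * (central_binom (int m) * sqrt (real m)) / sqrt 2)
     \<longlonglongrightarrow> (1 / sqrt pi) * (1 / sqrt pi) / sqrt 2"
    by (intro tendsto_intros central_binom_asymptotic
          filterlim_compose[OF central_binom_asymptotic] mult_nat_left_at_top) auto
  also have "(1 / sqrt pi) * (1 / sqrt pi) / sqrt 2 = 1 / (sqrt 2 * pi) * (1/2) ^ 0" by simp
  also have "(\<lambda>m. (central_binom (int (2 * m)) * sqrt (real (2 * m))) * (central_binom (int m) * sqrt (real m)) / sqrt 2)
     = (\<lambda>m. real m * shifted_weight m 0)"
  proof
    fix m
    have "sqrt (real (2 * m)) * sqrt (real m) / sqrt 2 = real m" by (simp add: real_sqrt_mult)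
    then show "(central_binom (int (2 * m)) * sqrt (real (2 * m))) * (central_binom (int m) * sqrt (real m)) / sqrt 2
      = real m * shifted_weight m 0"
      unfolding shifted_weight_0 by (metis (no_types, lifting) mult.assoc mult.commute times_divide_eq_left)
  qed
  finally show ?case .
next
  case (Suc j)
  have "(\<lambda>m. (real m + real j + 1/2) * (2 * real m + real j + 1/2) / (4 * (real m + real j + 1)\<^sup>2)) \<longlonglongrightarrow> 1/2"
    by real_asymp
  from tendsto_mult[OF this Suc] show ?case
    unfolding shifted_weight_Suc by (simp add: mult_ac)
qed

lemma sum_central_binom_half: "(\<lambda>j. central_binom (int j) * (1/2) ^ j) sums sqrt 2"
proof -
  have "(\<lambda>j. ((-1/2) gchoose j) * (-1/2) ^ j) sums (1 + (-1/2)) powr (-1/2 :: real)"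
    by (rule gen_binomial_real) simp
  moreover have "((-1/2) gchoose j) * (-1/2) ^ j = central_binom (int j) * (1/2 :: real) ^ j" for j
    by (simp add: gbinomial_pochhammer central_binom_of_nat power_mult_distrib[symmetric])
  moreover have "(1 + (-1/2)) powr (-1/2 :: real) = sqrt 2"
    by (simp add: powr_minus powr_half_sqrt powr_divide real_sqrt_divide inverse_eq_divide)
  ultimately show ?thesis by simp
qed

text \<open>
  The sum over $j$ is the same for every $m$, so it equals its limit for $m\to\infty$, which
  may be taken term by term.
\<close>

lemma wz_sum_value: "suminf (wz_term 0) = 4 / pi"
proof -
  define T where "T = (\<lambda>j m. central_binom (int j) * shifted_weight m j * (4 * real m + 6 * real j + 1))"
  define L where "L = 1 / (sqrt 2 * pi)"
  have lim0: "(\<lambda>m. shifted_weight m j) \<longlonglongrightarrow> 0" for j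
  proof -
    have "(\<lambda>m. (real m * shifted_weight m j) * (1 / real m)) \<longlonglongrightarrow> (L * (1/2) ^ j) * 0"
      unfolding L_def by (intro tendsto_mult shifted_weight_tendsto lim_1_over_n)
    moreover have "\<forall>\<^sub>F m in sequentially. (real m * shifted_weight m j) * (1 / real m) = shifted_weight m j"
      using eventually_gt_at_top[of 0] by eventually_elim simp
    ultimately show ?thesis by (simp add: Lim_transform_eventually)
  qed
  have lim: "T j \<longlonglongrightarrow> 4 * L * (central_binom (int j) * (1/2) ^ j)" for j
  proof -
    have "(\<lambda>m. central_binom (int j) * (4 * (real m * shifted_weight m j) + (6 * real j + 1) * shifted_weight m j))
      \<longlonglongrightarrow> central_binom (int j) * (4 * (L * (1/2) ^ j) + (6 * real j + 1) * 0)"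
      unfolding L_def by (intro tendsto_intros shifted_weight_tendsto lim0)
    then show ?thesis by (simp add: T_def algebra_simps)
  qed
  have "(\<lambda>m. (4 * real m + 1) * shifted_weight m 0) \<longlonglongrightarrow> 4 * L * (central_binom (int 0) * (1/2) ^ 0)"
    using lim[of 0] by (simp add: T_def central_binom_def mult_ac)
  \<comment> \<open>The case $j=0$ of the limit also bounds the $m$-dependent part of all summands.\<close>
  then have "Bseq (\<lambda>m. (4 * real m + 1) * shifted_weight m 0)"
    using convergent_imp_Bseq convergentI by blast
  then obtain K where K: "K > 0" "\<And>m. \<bar>(4 * real m + 1) * shifted_weight m 0\<bar> \<le> K"
    by (auto simp: Bseq_def)
  define M where "M = (\<lambda>j. K * ((6 * real j + 1) * (1/2) ^ j))"
  have bound: "norm (T j m) \<le> M j" for j m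
  proof -
    \<comment> \<open>The linear factor splits by $4m+6j+1\le(4m+1)(6j+1)$.\<close>
    have "T j m \<le> 1 * (shifted_weight m 0 * (1/2) ^ j) * ((4 * real m + 1) * (6 * real j + 1))"
      unfolding T_def
      by (intro mult_mono central_binom_bounds shifted_weight_le mult_nonneg_nonneg shifted_weight_nonneg)
         (auto simp: algebra_simps)
    also have "\<dots> = ((4 * real m + 1) * shifted_weight m 0) * ((6 * real j + 1) * (1/2) ^ j)" by simp
    also have "\<dots> \<le> M j" unfolding M_def
      using K(2)[of m] by (intro mult_right_mono) auto
    finally show ?thesis
      by (simp add: T_def central_binom_bounds shifted_weight_nonneg)
  qed
  have "summable M"
  proof -
    have "summable (\<lambda>j. (6 * real j + 1) * (1/2 :: real) ^ j)"
      by (rule summable_ratio_test[where c = "3/4" and N = 2]) (auto simp: field_simps)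
    then show ?thesis unfolding M_def by (rule summable_mult)
  qed
  then have "(\<lambda>m. \<Sum>j. T j m) \<longlonglongrightarrow> (\<Sum>j. 4 * L * (central_binom (int j) * (1/2) ^ j))"
    using tannerys_theorem[OF lim _ \<open>summable M\<close>] bound by (auto simp: case_prod_unfold)
  moreover have "(\<Sum>j. T j m) = suminf (wz_term 0)" for m
    using wz_term_neg_sums[of m] unfolding T_def by (simp add: sums_iff)
  moreover have "(\<Sum>j. 4 * L * (central_binom (int j) * (1/2) ^ j)) = 4 / pi"
    using sums_mult[OF sum_central_binom_half, of "4 * L"] by (simp add: sums_iff L_def)
  ultimately show ?thesis by (simp add: LIMSEQ_const_iff)
qed

section \<open>The original summand\<close>

text \<open>
  Apart from the common linear factor, the two sides agree at $n=0$, and both are multiplied by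
  the same rational function of $k$ and $n$ when $n$ grows by one.
\<close>

lemma summand_eq_wz_term:
  "pochhammer (1/2 :: real) k ^ 3 / (4 ^ k * fact k ^ 3)
      * ((\<Prod>j=1..2*n. 2 * real k + real j)
         / (\<Prod>j=1..n. (real k + real j)\<^sup>2 * (2 * real k - 2 * real j + 1)))
      * (6 * real k + 1 + 2 * real n)
   = (-1) ^ n * 2 ^ n / pochhammer (1/2) n * wz_term (int n) k"
proof -
  define R where "R = (\<lambda>n. (\<Prod>j=1..2*n. 2 * real k + real j)
         / (\<Prod>j=1..n. (real k + real j)\<^sup>2 * (2 * real k - 2 * real j + 1)))"
  have "central_binom (int k) * weight 0 k * R n = (-1) ^ n * 2 ^ n / pochhammer (1/2) n * (central_binom (int n + int k) * weight (int n) k)"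
  proof (induction n)
    case 0
    show ?case by (simp add: R_def)
  next
    case (Suc n)
    define x y where "x = real k" and "y = real n"
    define P where "P = (-1) ^ n * 2 ^ n / pochhammer (1/2 :: real) n"
    define a a' w w' where "a = central_binom (int n + int k)" and "a' = central_binom (int (Suc n) + int k)"
      and "w = weight (int n) k" and "w' = weight (int (Suc n)) k"
    have pos: "x \<ge> 0" "y \<ge> 0" by (simp_all add: x_def y_def)
    have nz: "2 * x - 2 * y - 1 \<noteq> 0" "x + y + 1 \<noteq> 0" "y + 1/2 \<noteq> 0"
      using half_odd_nonzero[of k "int n"] pos by (auto simp: x_def y_def)
    have R: "R (Suc n) = R n * (2 * (2 * x + 2 * y + 1) / ((x + y + 1) * (2 * x - 2 * y - 1)))"
    proof -
      have "R (Suc n) = R n * ((2 * x + 2 * y + 1) * (2 * (x + y + 1)) / ((x + y + 1)\<^sup>2 * (2 * x - 2 * y - 1)))"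
        by (simp add: R_def x_def y_def algebra_simps)
      moreover have "p * (2 * z) / (z\<^sup>2 * q) = 2 * p / (z * q)" if "z \<noteq> 0" for p q z :: real
        using that by (simp add: power2_eq_square)
      ultimately show ?thesis using nz(2) by (simp only: not_False_eq_True)
    qed
    have a: "a' = a * ((2 * x + 2 * y + 1) / (2 * (x + y + 1)))"
      using central_binom_rec[of "int n + int k"] nz by (simp add: a_def a'_def x_def y_def field_simps add_ac)
    have w: "w' = w * (- (2 * y + 1) / (2 * x - 2 * y - 1))"
      using weight_shift[of k "int n"] nz by (simp add: w_def w'_def x_def y_def field_simps add_ac)
    have P: "(-1) ^ Suc n * 2 ^ Suc n / pochhammer (1/2 :: real) (Suc n) = P * (- 4 / (2 * y + 1))"
      by (simp add: P_def y_def pochhammer_rec' divide_simps)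
    have "central_binom (int k) * weight 0 k * R (Suc n)
       = P * (a * w) * (2 * (2 * x + 2 * y + 1) / ((x + y + 1) * (2 * x - 2 * y - 1)))"
      using Suc unfolding R P_def a_def w_def by (simp only: mult.assoc[symmetric])
    also have "\<dots> = P * (- 4 / (2 * y + 1)) * (a' * w')"
      unfolding a w using nz by (simp add: divide_simps) algebra
    finally show ?case unfolding P a'_def w'_def .
  qed
  moreover have "pochhammer (1/2 :: real) k ^ 3 / (4 ^ k * fact k ^ 3) = central_binom (int k) * weight 0 k"
    by (simp add: central_binom_of_nat weight_def power3_eq_cube power2_eq_square mult_ac)
  moreover have "(\<Prod>j=1..2*n. 2 * real k + real j)
         / (\<Prod>j=1..n. (real k + real j)\<^sup>2 * (2 * real k - 2 * real j + 1)) = R n"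
    by (simp only: R_def)
  ultimately show ?thesis
    unfolding wz_term_def by (simp only: of_int_of_nat_eq mult.assoc[symmetric])
qed

theorem corollary6:
  shows "(\<forall>n::nat.
           (\<lambda>k::nat. pochhammer (1/2 :: real) k ^ 3 / (4 ^ k * fact k ^ 3)
              * ((\<Prod>j=1..2*n. 2 * real k + real j)
                 / (\<Prod>j=1..n. (real k + real j)\<^sup>2 * (2 * real k - 2 * real j + 1)))
              * (6 * real k + 1 + 2 * real n))
           sums ((-1) ^ n * 2 ^ (n + 2) / pochhammer (1/2) n * (1 / pi)))
       \<and> (\<lambda>k::nat. pochhammer (1/2 :: real) k ^ 3 / (4 ^ k * fact k ^ 3)
              * ((2 * real k + 1)\<^sup>2 / ((real k + 1) * (2 * real k - 1))))
           sums (- (8 / (3 * pi)))"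
    (is "(\<forall>n. ?f n sums ?s n) \<and> ?g sums _")
proof
  show *: "\<forall>n. ?f n sums ?s n"
  proof
    fix n
    have "wz_term (int n) sums (4 / pi)"
      using summable_sums[OF summable_wz_term, of "int n"] by (simp add: wz_sum_const[of "int n"] wz_sum_value)
    from sums_mult[OF this, of "(-1) ^ n * 2 ^ n / pochhammer (1/2) n"]
    show "?f n sums ?s n" unfolding summand_eq_wz_term by (simp add: mult_ac)
  qed
  have "?f 1 k = 6 * ?g k" for k
  proof -
    have "2 * real k - 1 \<noteq> 0" using half_odd_nonzero[of k 0] by simp
    then have ratio: "(2 * real k + 1) * (2 * real k + 2) / ((real k + 1)\<^sup>2 * (2 * real k - 1)) * (6 * real k + 3)
       = 6 * ((2 * real k + 1)\<^sup>2 / ((real k + 1) * (2 * real k - 1)))"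
      by (simp add: divide_simps) (simp add: algebra_simps power2_eq_square)
    have "{1..2 * 1} = {1, 2 :: nat}" by auto
    then have prods: "(\<Prod>j=1..2*1. 2 * real k + real j) = (2 * real k + 1) * (2 * real k + 2)"
        "(\<Prod>j=1..1. (real k + real j)\<^sup>2 * (2 * real k - 2 * real j + 1)) = (real k + 1)\<^sup>2 * (2 * real k - 1)"
      by simp_all
    have "6 * real k + 1 + 2 * real 1 = 6 * real k + 3" by simp
    then show ?thesis
      by (simp only: prods mult.assoc[of "pochhammer (1/2) k ^ 3 / (4 ^ k * fact k ^ 3)"] ratio mult.left_commute)
  qed
  then have "(\<lambda>k. 6 * ?g k) sums ?s 1" using * by (metis (no_types, lifting) ext)
  from sums_mult[OF this, of "1/6"] show "?g sums (- (8 / (3 * pi)))" by simp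
qed

end
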